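(* Every spin model $(W^+,d)$ admits a refinement $(W^+,V^+,d)$ of type II. Indeed, $I\in N_W$ and $J=\psi(I)\in N_W$; hence, if $\xi\in\mathbb C\setminus\{0\}$ is one of the four complex numbers such that $d=-\xi^2-\xi^{-2}$, the symmetric, type II matrix $(-\xi^{-3})I+\xi(J-I)\in N_W$ can be chosen as $V^+$. In other words, each spin model $(W^+,d)$ admits four type II refinements of the form $(W^+,V^+_{\rm Potts},d)$, where $V^+_{\rm Potts}=(-\xi^{-3})I+\xi(J-I)$. Moreover, $(V^+_{\rm Potts},d)$ is a Potts model.
   Context: Let $n\ge 2$, $X=\{1,\dots,n\}$, let $\mathrm{Mat}_X(\mathbb C)$ be the complex $n\times n$ matrices indexed by $X$, $I$ the identity, $J$ the all-ones matrix, $\circ$ the entrywise (Hadamard) product, and $d\in\{\pm\sqrt n\}$. For a symmetric $W^+\in\mathrm{Mat}_X(\mathbb C)$ with nonzero entries let $W^-$ be defined by $W^+\circ W^-=J$, and for $a,b\in X$ let $Y_{ab}\in\mathbb C^X$, $Y_{ab}(x)=W^+(x,a)/W^+(x,b)$. The pair $(W^+,d)$ is a *spin model* if $W^+Y_{ab}=d\,W^-(a,b)\,Y_{ab}$ for all $a,b\in X$. A *Potts model* is a spin model of the form $((-\xi^{-3})I+\xi(J-I),\,d)$ with $\xi\in\mathbb C\setminus\{0\}$ and $d=-\xi^2-\xi^{-2}$. The *Nomura algebra* $N_W\subset\mathrm{Mat}_X(\mathbb C)$ is the set of matrices having all vectors $Y_{ab}$ as eigenvectors; for $A\in N_W$,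 $\psi(A)\in\mathrm{Mat}_X(\mathbb C)$ is defined by $AY_{ab}=\psi(A)(a,b)Y_{ab}$. It is known that $N_W$ is closed under transposition, ordinary product and Hadamard product, that $\psi$ maps $N_W$ linearly isomorphically to $N_W$, and that $\psi^2=n\tau$ with $\tau$ transposition. For $A^+\in N_W$ put $A^-:=\psi(A^+)/d\in N_W$. The diagonals of $A^{\pm}$ are constant; write $\alpha_{A^\pm}:=A^\pm(a,a)$. A *refined spin model* is a triple $(W^+,V^+,d)$ with $(W^+,d)$ a spin model, $V^+\in N_W$ symmetric, and $\alpha_{V^+}\alpha_{V^-}\neq0$; it is called a refinement of $(W^+,d)$. It is *of type II* if moreover $V^+$ is a type II matrix, i.e. $V^+\circ V^-=J$, where $V^-=\psi(V^+)/d$. Refined spin models of the form $(W^+,V^+_{\rm Potts},d)$ are called *Potts-refined spin models*.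
   Formalization: Spin models are explicitly required to be type II (the known facts on ψ imply this; W=wJ with w²=d/n is a counterexample otherwise); the four ξ and refinements are distinct only for n≠4, since for n=4 (d=±2) there are two, each a double root, so four counts multiplicity there. *)

theory Defs
  imports "HOL-Analysis.Analysis" "HOL-Computational_Algebra.Computational_Algebra"
begin

text \<open>The set \<open>X\<close> is the finite index type, so \<open>n\<close> is \<open>CARD('n)\<close>, and the entry \<open>W(x, a)\<close> is
  \<open>W $ x $ a\<close>.\<close>

definition all_ones :: "complex^'n^'n" where
  "all_ones = (\<chi> x y. 1)"

definition hadamard :: "complex^'n^'n \<Rightarrow> complex^'n^'n \<Rightarrow> complex^'n^'n" where
  "hadamard A B = (\<chi> x y. A $ x $ y * B $ x $ y)"

text \<open>For \<open>W\<close> with nonzero entries this is the unique solution \<open>W\<^sup>-\<close> of \<open>hadamard W W\<^sup>- = all_ones\<close>.\<close>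

definition hadamard_inv :: "complex^'n^'n \<Rightarrow> complex^'n^'n" where
  "hadamard_inv W = (\<chi> x y. inverse (W $ x $ y))"

definition Yvec :: "complex^'n^'n \<Rightarrow> 'n \<Rightarrow> 'n \<Rightarrow> complex^'n" where
  "Yvec W a b = (\<chi> x. W $ x $ a / W $ x $ b)"

text \<open>The usual type II condition: for all \<open>a, b\<close>, the sum over \<open>x\<close> of \<open>W(a, x) / W(b, x)\<close> is \<open>n\<close> if
  \<open>a = b\<close> and \<open>0\<close> otherwise.\<close>

definition type_II_matrix :: "complex^'n^'n \<Rightarrow> bool" where
  "type_II_matrix W \<longleftrightarrow>
     (\<forall>x y. W $ x $ y \<noteq> 0) \<and>
     W ** transpose (hadamard_inv W) = mat (of_nat CARD('n))"

text \<open>The type II condition does not follow from the others: if \<open>w\<^sup>2 = d / n\<close> then \<open>W = w J\<close> satisfies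
  all of them, but its Nomura algebra is the algebra of all matrices with constant row sums. That
  algebra is not closed under transposition, and \<open>\<psi>\<close> is not injective on it. With the type II
  condition, the Nomura algebra contains \<open>J\<close> and \<open>\<psi>\<^sup>2 = n \<tau>\<close>.\<close>

definition spin_model :: "complex^'n^'n \<Rightarrow> complex \<Rightarrow> bool" where
  "spin_model W d \<longleftrightarrow>
     d \<in> {of_real (sqrt (real CARD('n))), - of_real (sqrt (real CARD('n)))} \<and>
     transpose W = W \<and>
     (\<forall>x y. W $ x $ y \<noteq> 0) \<and>
     type_II_matrix W \<and>
     (\<forall>a b. W *v Yvec W a b = (d * hadamard_inv W $ a $ b) *s Yvec W a b)"

definition nomura_algebra :: "complex^'n^'n \<Rightarrow> (complex^'n^'n) set" where
  "nomura_algebra W = {A. \<forall>a b. \<exists>c. A *v Yvec W a b = c *s Yvec W a b}"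

text \<open>The eigenvalue is unique because \<open>Yvec W a b\<close> has no zero entry.\<close>

definition psi :: "complex^'n^'n \<Rightarrow> complex^'n^'n \<Rightarrow> complex^'n^'n" where
  "psi W A = (\<chi> a b. THE c. A *v Yvec W a b = c *s Yvec W a b)"

text \<open>For \<open>A = A\<^sup>+\<close> in the Nomura algebra this is \<open>A\<^sup>- = \<psi>(A\<^sup>+) / d\<close>.\<close>

definition minus_part :: "complex^'n^'n \<Rightarrow> complex \<Rightarrow> complex^'n^'n \<Rightarrow> complex^'n^'n" where
  "minus_part W d A = (\<chi> a b. psi W A $ a $ b / d)"

definition diag_value :: "complex^'n^'n \<Rightarrow> complex" where
  "diag_value A = (THE c. \<forall>a. A $ a $ a = c)"

definition refined_spin_model :: "complex^'n^'n \<Rightarrow> complex^'n^'n \<Rightarrow> complex \<Rightarrow> bool" where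
  "refined_spin_model W V d \<longleftrightarrow>
     spin_model W d \<and> V \<in> nomura_algebra W \<and> transpose V = V \<and>
     diag_value V * diag_value (minus_part W d V) \<noteq> 0"

definition refined_spin_model_type_II ::
    "complex^'n^'n \<Rightarrow> complex^'n^'n \<Rightarrow> complex \<Rightarrow> bool" where
  "refined_spin_model_type_II W V d \<longleftrightarrow>
     refined_spin_model W V d \<and> hadamard V (minus_part W d V) = all_ones"

definition potts_matrix :: "complex \<Rightarrow> complex^'n^'n" where
  "potts_matrix \<xi> =
     (\<chi> x y. - (\<xi> powi (-3)) * mat 1 $ x $ y + \<xi> * (all_ones - mat 1) $ x $ y)"

definition potts_params :: "complex \<Rightarrow> complex set" where
  "potts_params d = {\<xi>. \<xi> \<noteq> 0 \<and> d = - (\<xi>\<^sup>2) - \<xi> powi (-2)}"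

definition potts_model :: "complex^'n^'n \<Rightarrow> complex \<Rightarrow> bool" where
  "potts_model V d \<longleftrightarrow> spin_model V d \<and> (\<exists>\<xi>\<in>potts_params d. V = potts_matrix \<xi>)"

text \<open>\<open>X\<^sup>4 + d X\<^sup>2 + 1\<close>, that is \<open>d = - X\<^sup>2 - X\<^sup>-\<^sup>2\<close> multiplied by \<open>X\<^sup>2\<close>. It has double roots exactly for
  \<open>d = 2\<close> and \<open>d = -2\<close>, that is for \<open>n = 4\<close>.\<close>

definition potts_poly :: "complex \<Rightarrow> complex poly" where
  "potts_poly d = [:1, 0, d, 0, 1:]"

end

theory Submission
  imports Defs
begin

text \<open>Let \<open>W\<close> be a symmetric type II matrix of size \<open>n = d\<^sup>2\<close>. The type II condition says that the
  coordinates of \<open>Y\<^sub>a\<^sub>b\<close> add up to \<open>n\<close> if \<open>a = b\<close> and to \<open>0\<close> otherwise; as \<open>Y\<^sub>a\<^sub>a\<close> is the all-ones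
  vector, every \<open>Y\<^sub>a\<^sub>b\<close> is an eigenvector of \<open>J\<close> (\<open>all_ones_eigenvector\<close>). A Potts matrix is
  \<open>V = (-\<xi>\<^sup>-\<^sup>3 - \<xi>) I + \<xi> J\<close>, so the \<open>Y\<^sub>a\<^sub>b\<close> are eigenvectors of \<open>V\<close> too, and when
  \<open>d = -\<xi>\<^sup>2 - \<xi>\<^sup>-\<^sup>2\<close> the eigenvalue is \<open>d \<xi>\<^sup>-\<^sup>1\<close> for \<open>a \<noteq> b\<close> and \<open>-d \<xi>\<^sup>3\<close> for \<open>a = b\<close>, which is
  \<open>d\<close> times the entrywise inverse of \<open>V\<close> (\<open>potts_eigenvector\<close>).

  This eigenvalue formula is used twice. Applied to the given \<open>W\<close>, it says that \<open>\<psi>(V) / d\<close> is the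
  entrywise inverse of \<open>V\<close>, so that \<open>V\<close> is a type II refinement of \<open>W\<close>. Applied to \<open>V\<close> itself, which
  is a type II matrix as well (\<open>potts_type_II\<close>), it is the spin model equation for \<open>V\<close>.

  The admissible \<open>\<xi>\<close> are the roots of \<open>X\<^sup>4 + d X\<^sup>2 + 1\<close>, four with multiplicity. A root that it shares
  with its derivative forces \<open>d\<^sup>2 = 4\<close>, so that for \<open>n \<noteq> 4\<close> there are four distinct ones
  (\<open>card_potts_params\<close>), and \<open>V\<close> determines \<open>\<xi>\<close> as its off-diagonal entry.\<close>

section \<open>The eigenvectors of a type II matrix\<close>

lemma sum_Yvec:
  fixes W :: "complex^'n^'n"
  assumes "type_II_matrix W" "transpose W = W"
  shows "(\<Sum>x\<in>UNIV. Yvec W a b $ x) = (if a = b then of_nat CARD('n) else 0)"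
proof -
  have sym: "W $ x $ y = W $ y $ x" for x y
    using assms(2) by (metis transpose_def vec_lambda_beta)
  have "(W ** transpose (hadamard_inv W)) $ a $ b = (mat (of_nat CARD('n)) :: complex^'n^'n) $ a $ b"
    using assms(1) by (simp add: type_II_matrix_def)
  then show ?thesis
    by (simp add: matrix_matrix_mult_def transpose_def hadamard_inv_def mat_def Yvec_def
        divide_inverse sym[of _ a] sym[of _ b])
qed

lemma eigenvalue_Yvec_unique:
  fixes W :: "complex^'n^'n"
  assumes "\<forall>x y. W $ x $ y \<noteq> 0" "c *s Yvec W a b = c' *s Yvec W a b"
  shows "c = c'"
proof -
  have "(c *s Yvec W a b) $ a = (c' *s Yvec W a b) $ a"
    by (simp only: assms(2))
  then show ?thesis
    using assms(1) by (simp add: Yvec_def)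
qed

text \<open>Eigenvalues on \<open>Y\<^sub>a\<^sub>b\<close> are unique, so exhibiting a matrix of eigenvalues determines \<open>\<psi>\<close> and
  disposes of the definite description in its definition.\<close>

lemma psi_eqI:
  fixes W A B :: "complex^'n^'n"
  assumes "\<forall>x y. W $ x $ y \<noteq> 0"
    and "\<And>a b. A *v Yvec W a b = B $ a $ b *s Yvec W a b"
  shows "psi W A = B"
proof -
  have "(THE c. A *v Yvec W a b = c *s Yvec W a b) = B $ a $ b" for a b
  proof (rule the_equality)
    show "A *v Yvec W a b = B $ a $ b *s Yvec W a b"
      by (rule assms(2))
    show "c = B $ a $ b" if "A *v Yvec W a b = c *s Yvec W a b" for c
      using that unfolding assms(2) by (rule eigenvalue_Yvec_unique[OF assms(1), symmetric])
  qed
  then show ?thesis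
    by (simp add: psi_def vec_eq_iff)
qed

lemma diag_value_eqI:
  fixes A :: "complex^'n^'n"
  shows "(\<And>a. A $ a $ a = c) \<Longrightarrow> diag_value A = c"
  by (simp add: diag_value_def)

lemma all_ones_eigenvector:
  fixes W :: "complex^'n^'n"
  assumes "type_II_matrix W" "transpose W = W"
  shows "all_ones *v Yvec W a b = (if a = b then of_nat CARD('n) else 0) *s Yvec W a b"
proof -
  have nz: "W $ x $ y \<noteq> 0" for x y
    using assms(1) by (simp add: type_II_matrix_def)
  have "(all_ones *v Yvec W a b) $ x = (if a = b then of_nat CARD('n) else 0)" for x
    using sum_Yvec[OF assms, of a b] by (simp add: matrix_vector_mult_def all_ones_def)
  then show ?thesis
    using nz by (simp add: vec_eq_iff) (simp add: Yvec_def)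
qed

section \<open>Potts matrices\<close>

lemma potts_matrix_entry:
  "(potts_matrix \<xi> :: complex^'n^'n) $ x $ y = (if x = y then - inverse (\<xi> ^ 3) else \<xi>)"
  by (simp add: potts_matrix_def all_ones_def mat_def power_int_def power_inverse)

lemma potts_matrix_nonzero: "\<xi> \<noteq> 0 \<Longrightarrow> (potts_matrix \<xi> :: complex^'n^'n) $ x $ y \<noteq> 0"
  by (simp add: potts_matrix_entry)

lemma potts_matrix_symmetric: "transpose (potts_matrix \<xi>) = potts_matrix \<xi>"
  by (simp add: vec_eq_iff transpose_def potts_matrix_entry eq_commute)

lemma potts_matrix_decomposition:
  fixes v :: "complex^'n"
  shows "potts_matrix \<xi> *v v = (- inverse (\<xi> ^ 3) - \<xi>) *s v + \<xi> *s (all_ones *v v)"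
proof -
  have "(potts_matrix \<xi> *v v) $ x = ((- inverse (\<xi> ^ 3) - \<xi>) *s v + \<xi> *s (all_ones *v v)) $ x" for x
  proof -
    have "(potts_matrix \<xi> *v v) $ x
        = (\<Sum>y\<in>UNIV. (if x = y then (- inverse (\<xi> ^ 3) - \<xi>) * v $ y else 0) + \<xi> * v $ y)"
      unfolding matrix_vector_mult_def
      by (auto simp: potts_matrix_entry algebra_simps intro!: sum.cong)
    also have "\<dots> = ((- inverse (\<xi> ^ 3) - \<xi>) *s v + \<xi> *s (all_ones *v v)) $ x"
      by (simp add: sum.distrib matrix_vector_mult_def all_ones_def sum_distrib_left left_diff_distrib)
    finally show ?thesis .
  qed
  then show ?thesis
    by (simp add: vec_eq_iff)
qed

lemma potts_params_iff: "\<xi> \<in> potts_params d \<longleftrightarrow> \<xi> \<noteq> 0 \<and> d = - (\<xi>\<^sup>2) - inverse (\<xi>\<^sup>2)"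
  by (simp add: potts_params_def power_int_def power_inverse)

text \<open>On \<open>Y\<^sub>a\<^sub>b\<close> the matrix acts as \<open>(-\<xi>\<^sup>-\<^sup>3 - \<xi>) + \<xi> \<cdot> n \<cdot> [a = b]\<close>. The equation for \<open>d\<close> turns
  \<open>-\<xi>\<^sup>-\<^sup>3 - \<xi>\<close> into \<open>d \<xi>\<^sup>-\<^sup>1\<close>, and with \<open>n = d\<^sup>2\<close> the diagonal case becomes \<open>d (\<xi>\<^sup>-\<^sup>1 + \<xi> d) = -d \<xi>\<^sup>3\<close>.
  Stated for symmetric type II matrices rather than for spin models, it also applies with a
  Potts matrix as \<open>W\<close>, where it is the spin model equation.\<close>

lemma potts_eigenvector:
  fixes W :: "complex^'n^'n"
  assumes W: "type_II_matrix W" "transpose W = W"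
    and d: "d\<^sup>2 = of_nat CARD('n)" and \<xi>: "\<xi> \<in> potts_params d"
  shows "potts_matrix \<xi> *v Yvec W a b =
    (d * hadamard_inv (potts_matrix \<xi> :: complex^'n^'n) $ a $ b) *s Yvec W a b"
proof -
  have nz: "\<xi> \<noteq> 0" and d_eq: "d = - (\<xi>\<^sup>2) - inverse (\<xi>\<^sup>2)"
    using \<xi> by (simp_all add: potts_params_iff)
  have off_diag: "- inverse (\<xi> ^ 3) - \<xi> = d * inverse \<xi>"
    using nz by (simp add: d_eq field_simps eval_nat_numeral)
  have diag: "d * inverse \<xi> + \<xi> * d\<^sup>2 = - (d * \<xi> ^ 3)"
    using nz by (simp add: d_eq field_simps eval_nat_numeral)
  have "potts_matrix \<xi> *v Yvec W a b
      = (d * inverse \<xi> + \<xi> * (if a = b then d\<^sup>2 else 0)) *s Yvec W a b"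
    unfolding potts_matrix_decomposition all_ones_eigenvector[OF W] off_diag d
    by (simp add: vec_eq_iff algebra_simps)
  also have "d * inverse \<xi> + \<xi> * (if a = b then d\<^sup>2 else 0)
      = d * hadamard_inv (potts_matrix \<xi> :: complex^'n^'n) $ a $ b"
    using diag by (simp add: hadamard_inv_def potts_matrix_entry)
  finally show ?thesis .
qed

text \<open>Two distinct rows of a Potts matrix have entrywise quotient \<open>-\<xi>\<^sup>-\<^sup>4\<close> at one place, \<open>-\<xi>\<^sup>4\<close> at
  another, and \<open>1\<close> at the other \<open>n - 2\<close> places; the sum vanishes since
  \<open>n = d\<^sup>2 = \<xi>\<^sup>4 + 2 + \<xi>\<^sup>-\<^sup>4\<close>.\<close>

lemma potts_type_II:
  assumes d: "d\<^sup>2 = of_nat CARD('n)" and \<xi>: "\<xi> \<in> potts_params d"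
  shows "type_II_matrix (potts_matrix \<xi> :: complex^'n^'n)"
proof -
  let ?V = "potts_matrix \<xi> :: complex^'n^'n"
  have nz: "\<xi> \<noteq> 0" and d_eq: "d = - (\<xi>\<^sup>2) - inverse (\<xi>\<^sup>2)"
    using \<xi> by (simp_all add: potts_params_iff)
  have n: "\<xi> ^ 4 + inverse (\<xi> ^ 4) = of_nat CARD('n) - 2"
    using nz by (simp add: d[symmetric] d_eq field_simps eval_nat_numeral)
  have "(?V ** transpose (hadamard_inv ?V)) $ a $ b = mat (of_nat CARD('n)) $ a $ b" for a b
  proof (cases "a = b")
    case True
    then show ?thesis
      using nz by (simp add: matrix_matrix_mult_def transpose_def hadamard_inv_def mat_def
          potts_matrix_nonzero)
  next
    case False
    \<comment> \<open>The constant \<open>1\<close>, corrected at the two exceptional places \<open>x = a\<close> and \<open>x = b\<close>.\<close>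
    have "(?V ** transpose (hadamard_inv ?V)) $ a $ b
        = (\<Sum>x\<in>UNIV. (if a = x then - inverse (\<xi> ^ 4) - 1 else 0)
            + ((if b = x then - (\<xi> ^ 4) - 1 else 0) + 1))"
      using False nz unfolding matrix_matrix_mult_def transpose_def hadamard_inv_def
      by (auto simp: potts_matrix_entry field_simps eval_nat_numeral intro!: sum.cong)
    also have "\<dots> = of_nat CARD('n) - 2 - (\<xi> ^ 4 + inverse (\<xi> ^ 4))"
      by (simp add: sum.distrib)
    finally show ?thesis
      using n False by (simp add: mat_def)
  qed
  then show ?thesis
    using nz by (simp add: type_II_matrix_def vec_eq_iff potts_matrix_nonzero)
qed

section \<open>Counting the parameters\<close>

lemma poly_potts_poly_eq_0_iff: "poly (potts_poly d) \<xi> = 0 \<longleftrightarrow> \<xi> \<in> potts_params d"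
proof (cases "\<xi> = 0")
  case True
  then show ?thesis by (simp add: potts_poly_def potts_params_iff)
next
  case False
  then have "\<xi> \<in> potts_params d \<longleftrightarrow> d * \<xi>\<^sup>2 = - (\<xi> ^ 4) - 1"
    by (simp add: potts_params_iff field_simps eval_nat_numeral)
  also have "\<dots> \<longleftrightarrow> poly (potts_poly d) \<xi> = 0"
    by (simp add: potts_poly_def eq_diff_eq eq_neg_iff_add_eq_0)
      (simp add: algebra_simps eval_nat_numeral)
  finally show ?thesis by simp
qed

lemma potts_poly_nonzero: "potts_poly d \<noteq> 0"
  by (simp add: potts_poly_def)

lemma set_proots_potts_poly: "set_mset (proots (potts_poly d)) = potts_params d"
  by (auto simp: potts_poly_nonzero poly_potts_poly_eq_0_iff)

lemma size_proots_potts_poly: "size (proots (potts_poly d)) = 4"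
  by (simp add: size_proots_complex) (simp add: potts_poly_def)

text \<open>A common root \<open>x\<close> of \<open>X\<^sup>4 + d X\<^sup>2 + 1\<close> and its derivative \<open>2 X (2 X\<^sup>2 + d)\<close> is nonzero, hence
  \<open>d = -2 x\<^sup>2\<close>; substituting gives \<open>x\<^sup>4 = 1\<close> and so \<open>d\<^sup>2 = 4\<close>.\<close>

lemma card_potts_params:
  assumes "d\<^sup>2 \<noteq> 4"
  shows "card (potts_params d) = 4"
proof -
  have "rsquarefree (potts_poly d)"
    unfolding rsquarefree_roots
  proof (intro allI notI, elim conjE)
    fix x assume 0: "poly (potts_poly d) x = 0" and 1: "poly (pderiv (potts_poly d)) x = 0"
    have x: "x \<noteq> 0"
      using 0 by (auto simp: potts_poly_def)
    have "2 * x * (d + 2 * x\<^sup>2) = 0"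
      using 1 by (simp add: potts_poly_def pderiv_pCons algebra_simps eval_nat_numeral)
    then have d: "d = - 2 * x\<^sup>2"
      using x by (simp add: eq_neg_iff_add_eq_0)
    have "d\<^sup>2 = 4 * (x\<^sup>2)\<^sup>2"
      by (simp add: d power_mult_distrib)
    moreover have "(x\<^sup>2)\<^sup>2 = 1"
      using 0 by (simp add: d potts_poly_def algebra_simps eval_nat_numeral)
    ultimately show False
      using assms by simp
  qed
  then have simple: "count (proots (potts_poly d)) x = 1" if "x \<in> potts_params d" for x
    using that by (simp add: rsquarefree_root_order potts_poly_nonzero poly_potts_poly_eq_0_iff)
  have "size (proots (potts_poly d)) = (\<Sum>x\<in>potts_params d. count (proots (potts_poly d)) x)"
    by (simp only: size_multiset_overloaded_eq set_proots_potts_poly)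
  also have "\<dots> = (\<Sum>x\<in>potts_params d. 1)"
    by (rule sum.cong) (simp_all only: simple)
  finally show ?thesis
    by (simp add: size_proots_potts_poly)
qed

lemma inj_potts_matrix:
  assumes "CARD('n) \<ge> 2"
  shows "inj (potts_matrix :: complex \<Rightarrow> complex^'n^'n)"
proof -
  obtain a b :: 'n where "a \<noteq> b"
    using assms by (metis (full_types) UNIV_eq_I card_1_singleton_iff
        not_less_eq_eq numeral_2_eq_2 order_refl singletonI)
  then show ?thesis
    by (intro injI) (metis potts_matrix_entry)
qed

section \<open>Spin models and refinements from Potts matrices\<close>

lemma spin_model_potts:
  assumes "d \<in> {of_real (sqrt (real CARD('n))), - of_real (sqrt (real CARD('n)))}"
    and "d\<^sup>2 = of_nat CARD('n)" and \<xi>: "\<xi> \<in> potts_params d"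
  shows "spin_model (potts_matrix \<xi> :: complex^'n^'n) d"
  using assms potts_type_II[OF assms(2,3)]
    potts_eigenvector[OF potts_type_II[OF assms(2,3)] potts_matrix_symmetric assms(2,3)]
  by (simp add: spin_model_def potts_matrix_symmetric potts_matrix_nonzero potts_params_iff)

lemma potts_refinement:
  fixes W :: "complex^'n^'n"
  assumes W: "spin_model W d" and d: "d\<^sup>2 = of_nat CARD('n)" and \<xi>: "\<xi> \<in> potts_params d"
  shows "refined_spin_model_type_II W (potts_matrix \<xi>) d"
proof -
  let ?V = "potts_matrix \<xi> :: complex^'n^'n"
  have nz: "\<xi> \<noteq> 0" using \<xi> by (simp add: potts_params_iff)
  have d0: "d \<noteq> 0" using d by auto
  have W_type_II: "type_II_matrix W" "transpose W = W" and W_nz: "\<forall>x y. W $ x $ y \<noteq> 0"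
    using W by (simp_all add: spin_model_def)
  note eig = potts_eigenvector[OF W_type_II d \<xi>]
  have "psi W ?V = (\<chi> a b. d * hadamard_inv ?V $ a $ b)"
    by (rule psi_eqI[OF W_nz]) (simp add: eig)
  then have minus: "minus_part W d ?V = hadamard_inv ?V"
    using d0 by (simp add: minus_part_def vec_eq_iff)
  have diag: "diag_value ?V = - inverse (\<xi> ^ 3)" "diag_value (hadamard_inv ?V) = - (\<xi> ^ 3)"
    by (auto intro!: diag_value_eqI simp: hadamard_inv_def potts_matrix_entry)
  have "?V \<in> nomura_algebra W"
    using eig by (auto simp: nomura_algebra_def)
  moreover have "hadamard ?V (hadamard_inv ?V) = all_ones"
    using nz by (simp add: hadamard_def hadamard_inv_def all_ones_def vec_eq_iff
        potts_matrix_nonzero)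
  ultimately show ?thesis
    using W nz by (simp add: refined_spin_model_type_II_def refined_spin_model_def minus diag
        potts_matrix_symmetric)
qed

theorem mainTheorem2:
  fixes W :: "complex^'n^'n" and d :: complex
  assumes "CARD('n) \<ge> 2"
    and "spin_model W d"
  shows "(\<exists>V. refined_spin_model_type_II W V d) \<and>
    mat 1 \<in> nomura_algebra W \<and>
    all_ones = psi W (mat 1) \<and>
    all_ones \<in> nomura_algebra W \<and>
    (\<forall>\<xi>\<in>potts_params d.
       transpose (potts_matrix \<xi> :: complex^'n^'n) = potts_matrix \<xi> \<and>
       (potts_matrix \<xi> :: complex^'n^'n) \<in> nomura_algebra W \<and>
       type_II_matrix (potts_matrix \<xi> :: complex^'n^'n) \<and>
       refined_spin_model_type_II W (potts_matrix \<xi>) d \<and>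
       potts_model (potts_matrix \<xi> :: complex^'n^'n) d) \<and>
    set_mset (proots (potts_poly d)) = potts_params d \<and>
    size (proots (potts_poly d)) = 4 \<and>
    inj_on (potts_matrix :: complex \<Rightarrow> complex^'n^'n) (potts_params d) \<and>
    (CARD('n) \<noteq> 4 \<longrightarrow>
       card (potts_params d) = 4 \<and>
       card {V. refined_spin_model_type_II W V d \<and> (\<exists>\<xi>\<in>potts_params d. V = potts_matrix \<xi>)} = 4)"
proof -
  have W: "type_II_matrix W" "transpose W = W" and W_nz: "\<forall>x y. W $ x $ y \<noteq> 0"
    and d_sign: "d \<in> {of_real (sqrt (real CARD('n))), - of_real (sqrt (real CARD('n)))}"
    using assms(2) by (simp_all add: spin_model_def)
  have d: "d\<^sup>2 = of_nat CARD('n)"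
    using d_sign by (auto simp flip: of_real_power)
  have refined: "refined_spin_model_type_II W (potts_matrix \<xi>) d" if "\<xi> \<in> potts_params d" for \<xi>
    using potts_refinement[OF assms(2) d that] .
  have "potts_params d \<noteq> {}"
    using set_proots_potts_poly[of d] size_proots_potts_poly[of d]
    by (metis set_mset_eq_empty_iff size_empty zero_neq_numeral)
  then have ex: "\<exists>V. refined_spin_model_type_II W V d"
    using refined by blast
  have one: "mat 1 \<in> nomura_algebra W"
    by (auto simp: nomura_algebra_def intro: exI[of _ 1])
  have psi_one: "all_ones = psi W (mat 1)"
    by (rule psi_eqI[symmetric, OF W_nz]) (simp add: all_ones_def)
  have ones: "all_ones \<in> nomura_algebra W"
    using all_ones_eigenvector[OF W] by (auto simp: nomura_algebra_def)
  have potts: "transpose (potts_matrix \<xi> :: complex^'n^'n) = potts_matrix \<xi> \<and>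
       (potts_matrix \<xi> :: complex^'n^'n) \<in> nomura_algebra W \<and>
       type_II_matrix (potts_matrix \<xi> :: complex^'n^'n) \<and>
       refined_spin_model_type_II W (potts_matrix \<xi>) d \<and>
       potts_model (potts_matrix \<xi> :: complex^'n^'n) d" if "\<xi> \<in> potts_params d" for \<xi>
    using refined[OF that] spin_model_potts[OF d_sign d that] potts_type_II[OF d that] that
    by (auto simp: potts_model_def potts_matrix_symmetric refined_spin_model_type_II_def
        refined_spin_model_def)
  have inj: "inj_on (potts_matrix :: complex \<Rightarrow> complex^'n^'n) (potts_params d)"
    using inj_potts_matrix[OF assms(1)] by (rule inj_on_subset) simp
  have count: "card (potts_params d) = 4 \<and>
       card {V. refined_spin_model_type_II W V d \<and> (\<exists>\<xi>\<in>potts_params d. V = potts_matrix \<xi>)} = 4"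
    if "CARD('n) \<noteq> 4"
  proof -
    have "d\<^sup>2 \<noteq> 4"
      unfolding d using that by (metis of_nat_eq_iff of_nat_numeral)
    then have "card (potts_params d) = 4"
      by (rule card_potts_params)
    moreover have "{V. refined_spin_model_type_II W V d \<and> (\<exists>\<xi>\<in>potts_params d. V = potts_matrix \<xi>)}
        = potts_matrix ` potts_params d"
      using refined by auto
    ultimately show ?thesis
      using card_image[OF inj] by simp
  qed
  show ?thesis
    using ex one psi_one ones potts set_proots_potts_poly size_proots_potts_poly inj count by blast
qed

end
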